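(* There exist convex functions $F, G \in \Sigma$ and a parameter $\lambda \in (0,1)$ such that the convex linear combination $H = \lambda F + (1-\lambda) G$ is not convex, i.e. the set $\mathbb{C} \setminus H(\Delta^* )$ is not a bounded convex set.
   Context: Let $\Delta^* = \{z \in \mathbb{C} : |z| > 1\}$. The class $\Sigma$ consists of the functions $f$ that are analytic and univalent (injective) in $\Delta^*$ with a Laurent expansion of the form $f(z) = z + b_0 + \sum_{n=1}^\infty b_n z^{-n}$ for $z \in \Delta^*$ (so $f$ has a simple pole at $\infty$), with $b_n \in \mathbb{C}$. A function $f \in \Sigma$ is called convex (exterior convex) if the complement $E = \mathbb{C} \setminus f(\Delta^* )$ is a bounded convex set. It is a known theorem of Pommerenke that if $F, G \in \Sigma$ are convex and $0<\lambda<1$ then $\lambda F + (1-\lambda)G \in \Sigma$. A classical criterion states that a locally univalent function $f$ in $\Delta^*$ with a Laurent expansion of the form $f(z) = z + b_0 + \sum_{n=1}^\infty b_n z^{-n}$ for $z \in \Delta^*$ is univalent and exterior convex if and only if $\operatorname{Re}\left(1 + \frac{z f''(z)}{f'(z)}\right) > 0$ for all $z \in \Delta^*$. *)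

theory Defs
  imports "HOL-Analysis.Analysis"
begin

definition ext_disk :: "complex set" where
  "ext_disk = {z. norm z > 1}"

text \<open>Functions are total on \<^typ>\<open>complex\<close>; their values outside \<^term>\<open>ext_disk\<close> are
  irrelevant throughout.\<close>

definition class_Sigma :: "(complex \<Rightarrow> complex) set" where
  "class_Sigma = {f. f analytic_on ext_disk \<and> inj_on f ext_disk \<and>
     (\<exists>b :: nat \<Rightarrow> complex. \<forall>z\<in>ext_disk.
        (\<lambda>n. b (Suc n) / z ^ Suc n) sums (f z - (z + b 0)))}"

definition omitted_set :: "(complex \<Rightarrow> complex) \<Rightarrow> complex set" where
  "omitted_set f = - (f ` ext_disk)"

definition exterior_convex :: "(complex \<Rightarrow> complex) \<Rightarrow> bool" where
  "exterior_convex f \<longleftrightarrow>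
     f \<in> class_Sigma \<and> bounded (omitted_set f) \<and> convex (omitted_set f)"

end

theory Submission
  imports Defs "HOL-Complex_Analysis.Cauchy_Integral_Formula"
begin

text \<open>
  The map \<open>F z = z + a / z\<close> with \<open>norm a = 1\<close> omits a segment, and the map \<open>G\<close> determined by
  \<open>(G - 3/2) / (G + 3/2) = ((z - 1) / (z + 1)) powr (3/2)\<close> omits the lens cut out by two discs that
  meet at right angles in \<open>-3/2\<close> and \<open>3/2\<close>. Near \<open>z = 1\<close> the mean \<open>H = (F + G) / 2\<close> behaves like
  \<open>H 1 + (1 - a) (z - 1) / 2 + c (z - 1) powr (3/2)\<close> with \<open>c > 0\<close>, so the boundary of its omitted set
  bends outwards on one side of \<open>H 1\<close> as soon as \<open>\<bar>Arg (1 - a)\<bar> > \<pi> / 4\<close>.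

  Everything becomes rational in \<open>s = csqrt ((z - 1) / (z + 1))\<close>, which ranges over the sector
  \<open>\<bar>Im s\<bar> < Re s\<close>. On the closed exterior of the disc the difference quotients of \<open>F\<close> and \<open>G\<close> have
  nonnegative and positive real part, so \<open>H\<close> omits its own boundary values. Some value of
  \<open>H\<close>, taken at a rational \<open>s\<close> inside the sector, lies in the triangle spanned by three such boundary values.
\<close>

section \<open>The sector, and membership in \<open>class_Sigma\<close>\<close>

definition wedge :: "complex set" where
  "wedge = {s. \<bar>Im s\<bar> < Re s}"

lemma one_in_wedge: "1 \<in> wedge"
  by (simp add: wedge_def)

lemma ext_diskD: "z \<in> ext_disk \<Longrightarrow> z \<noteq> 0 \<and> z \<noteq> 1 \<and> z \<noteq> - 1 \<and> 1 / z \<in> ball 0 1"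
  by (auto simp: ext_disk_def norm_divide divide_less_eq)

text \<open>The substitution \<open>w = 1 / z\<close> turns the Laurent series at infinity into a
  Taylor series at 0: the coefficients \<open>b n\<close> are those of \<open>k\<close>, and
  \<open>k 0\<close> is the constant term.\<close>

lemma class_SigmaI:
  assumes k: "k holomorphic_on ball 0 1" and inj: "inj_on f ext_disk"
    and f: "\<And>z. z \<in> ext_disk \<Longrightarrow> f z = z + k (1 / z)"
  shows "f \<in> class_Sigma"
proof -
  have op: "open ext_disk"
    unfolding ext_disk_def by (intro open_Collect_less continuous_intros)
  have "(\<lambda>z. z + k (1 / z)) holomorphic_on ext_disk"
    by (intro holomorphic_intros holomorphic_on_compose_gen[OF _ k, unfolded o_def])
      (auto dest: ext_diskD)
  then have "f holomorphic_on ext_disk"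
    using f by (simp cong: holomorphic_cong)
  then have an: "f analytic_on ext_disk"
    using op by (simp add: analytic_on_open)
  define b where "b n = (deriv ^^ n) k 0 / fact n" for n
  have "(\<lambda>n. b (Suc n) / z ^ Suc n) sums (f z - (z + b 0))" if z: "z \<in> ext_disk" for z
  proof -
    have "(\<lambda>n. b n * (1 / z - 0) ^ n) sums k (1 / z)"
      unfolding b_def using holomorphic_power_series[OF k] ext_diskD[OF z] by blast
    then have "(\<lambda>n. b n / z ^ n) sums k (1 / z)"
      by (simp add: power_divide)
    then show ?thesis
      using f[OF z] by (subst sums_Suc_iff) simp
  qed
  then show ?thesis
    using an inj by (auto simp: class_Sigma_def)
qed

section \<open>The map omitting a segment\<close>

text \<open>The equation \<open>u + 1 / u = w\<close> is quadratic in \<open>u\<close> with roots of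
  product 1. Either one root lies outside the unit circle, or both lie on it; then they are
  conjugate and their sum \<open>w\<close> is a real number in \<open>{-2..2}\<close>.\<close>

lemma joukowski_image: "(\<lambda>u. u + 1 / u) ` ext_disk = - (complex_of_real ` {-2..2})"
proof (intro set_eqI iffI)
  fix w assume "w \<in> (\<lambda>u. u + 1 / u) ` ext_disk"
  then obtain u where u: "norm u > 1" and w: "w = u + 1 / u"
    by (auto simp: ext_disk_def)
  have u0: "u \<noteq> 0" using u by auto
  show "w \<in> - (complex_of_real ` {-2..2})"
  proof
    assume "w \<in> complex_of_real ` {-2..2}"
    then obtain x where x: "\<bar>x\<bar> \<le> 2" and ux: "u + 1 / u = of_real x"
      using w by force
    have "u * u - of_real x * u + 1 = 0"
      using ux u0 by (simp add: field_simps)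
    then have re: "(Re u)\<^sup>2 - (Im u)\<^sup>2 - x * Re u + 1 = 0" and im: "Im u * (2 * Re u - x) = 0"
      by (simp_all add: complex_eq_iff power2_eq_square algebra_simps)
    have n: "(Re u)\<^sup>2 + (Im u)\<^sup>2 > 1"
      using u by (simp add: cmod_def)
    \<comment> \<open>A real root would satisfy
      \<open>(\<bar>Re u\<bar> - 1)\<^sup>2 \<le> 0\<close>; a non-real root has its conjugate as
      the other root, which forces norm 1.\<close>
    show False
    proof (cases "Im u = 0")
      case True
      have "\<bar>Re u\<bar> > 1"
        using n True by (simp add: abs_square_less_1 flip: not_le) (metis abs_square_le_1 not_le)
      have "(Re u)\<^sup>2 + 1 = x * Re u" using re True by simp
      also have "\<dots> \<le> 2 * \<bar>Re u\<bar>"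
        using x by (metis abs_ge_self abs_ge_zero abs_mult mult_right_mono order_trans)
      finally have "(\<bar>Re u\<bar> - 1)\<^sup>2 \<le> 0"
        by (simp add: power2_eq_square algebra_simps)
      then show False using \<open>\<bar>Re u\<bar> > 1\<close> by simp
    next
      case False
      then have "x = 2 * Re u" using im by simp
      then show False using re n by (simp add: power2_eq_square)
    qed
  qed
next
  fix w assume w: "w \<in> - (complex_of_real ` {-2..2})"
  define d where "d = csqrt (w\<^sup>2 - 4)"
  define u where "u = (w + d) / 2"
  define v where "v = (w - d) / 2"
  have "d\<^sup>2 = w\<^sup>2 - 4" by (simp add: d_def)
  then have uv: "u * v = 1" by (simp add: u_def v_def field_simps power2_eq_square)
  have sum: "u + v = w" by (simp add: u_def v_def field_simps)
  have u0: "u \<noteq> 0" "v \<noteq> 0" using uv by auto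
  then have inv: "v = 1 / u" "u = 1 / v" using uv by (simp_all add: field_simps)
  have "norm u \<noteq> 1"
  proof
    assume n: "norm u = 1"
    have "u * cnj u = 1"
      using n by (simp add: complex_norm_square[symmetric])
    then have "u * (v - cnj u) = 0"
      using uv by (simp add: algebra_simps)
    then have "v = cnj u" using u0 by simp
    then have "w = of_real (2 * Re u)"
      using sum by (simp add: complex_eq_iff)
    moreover have "\<bar>Re u\<bar> \<le> 1" using n abs_Re_le_cmod[of u] by simp
    moreover have "2 * Re u \<in> {-2..2}" using calculation(2) by auto
    ultimately show False using w by blast
  qed
  moreover have "norm u * norm v = 1" using uv by (metis norm_mult norm_one)
  ultimately consider "norm u > 1" | "norm v > 1"
    by (smt (verit) mult_le_one norm_ge_zero mult_cancel_left2 mult_left_le)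
  then show "w \<in> (\<lambda>u. u + 1 / u) ` ext_disk"
  proof cases
    case 1
    then show ?thesis
      using sum inv(1) by (intro image_eqI[of _ _ u]) (auto simp: ext_disk_def)
  next
    case 2
    then show ?thesis
      using sum inv(2) by (intro image_eqI[of _ _ v]) (auto simp: ext_disk_def add.commute)
  qed
qed

text \<open>With \<open>b * b = a\<close> the rotation \<open>z = b * u\<close> gives
  \<open>z + a / z = b * (u + 1 / u)\<close>, so the omitted set is a rotated copy of the segment
  from -2 to 2.\<close>

lemma exterior_convex_segment:
  assumes a: "norm a = 1"
  shows "exterior_convex (\<lambda>z. z + a / z)"
proof -
  define b where "b = csqrt a"
  have b2: "b * b = a" by (simp add: b_def flip: power2_eq_square)
  have b1: "norm b = 1" using a by (simp add: b_def)
  then have b0: "b \<noteq> 0" by auto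
  have "inj_on (\<lambda>z. z + a / z) ext_disk"
  proof
    fix z y assume z: "z \<in> ext_disk" and y: "y \<in> ext_disk" and eq: "z + a / z = y + a / y"
    have "(z - y) * (z * y - a) = 0"
      using eq ext_diskD[OF z] ext_diskD[OF y] by (simp add: field_simps)
    moreover have "norm (z * y) > 1"
      using z y by (simp add: ext_disk_def norm_mult less_1_mult)
    ultimately show "z = y" using a by auto
  qed
  then have cls: "(\<lambda>z. z + a / z) \<in> class_Sigma"
    by (intro class_SigmaI[of "\<lambda>w. a * w"] holomorphic_intros) auto
  have rot: "(*) b ` ext_disk = ext_disk"
  proof
    show "(*) b ` ext_disk \<subseteq> ext_disk"
      using b1 by (auto simp: ext_disk_def norm_mult)
    show "ext_disk \<subseteq> (*) b ` ext_disk"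
    proof
      fix z assume "z \<in> ext_disk"
      then show "z \<in> (*) b ` ext_disk"
        using b0 b1 by (intro image_eqI[of _ _ "z / b"]) (auto simp: ext_disk_def norm_divide)
    qed
  qed
  have "(\<lambda>z. z + a / z) ` ext_disk = (\<lambda>z. z + a / z) ` (*) b ` ext_disk"
    by (simp add: rot)
  also have "\<dots> = (*) b ` (\<lambda>u. u + 1 / u) ` ext_disk"
    using b0 by (auto simp: image_image algebra_simps simp flip: b2 intro!: image_cong)
  also have "\<dots> = - ((*) b ` complex_of_real ` {-2..2})"
  proof -
    have "bij ((*) b)"
      using b0 by (intro bijI') (auto intro!: exI[of _ "_ / b"])
    then show ?thesis
      by (simp add: joukowski_image bij_image_Compl_eq)
  qed
  finally have om: "omitted_set (\<lambda>z. z + a / z) = (*) b ` complex_of_real ` {-2..2}"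
    by (simp add: omitted_set_def)
  have "compact ((*) b ` complex_of_real ` {-2..2})"
    by (intro compact_continuous_image continuous_intros compact_Icc)
  moreover have "convex ((*) b ` complex_of_real ` {-2..2})"
    by (intro convex_linear_image bounded_linear.linear bounded_linear_of_real
        bounded_linear_mult_right) simp
  ultimately show ?thesis
    using cls by (simp add: exterior_convex_def om compact_imp_bounded)
qed

section \<open>Cubing on the sector\<close>

text \<open>One argument is below pi/4 and the other at most pi/4 in modulus, so their sum stays
  below pi/2.\<close>

lemma Re_mult_wedge:
  assumes "\<bar>Im s\<bar> < Re s" "\<bar>Im r\<bar> \<le> Re r" "r \<noteq> 0"
  shows "0 < Re (s * r)"
proof -
  have "Im s * Im r \<le> \<bar>Im s\<bar> * \<bar>Im r\<bar>" by (metis abs_ge_self abs_mult)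
  also have "\<dots> \<le> \<bar>Im s\<bar> * Re r" using assms by (intro mult_left_mono) auto
  also have "\<dots> < Re s * Re r"
  proof (rule mult_strict_right_mono)
    show "Re r > 0" using assms by (auto simp: complex_eq_iff) 
  qed (use assms in auto)
  finally show ?thesis by simp
qed

lemma wedge_cube_inj:
  assumes "s \<in> wedge" "r \<in> wedge" "s ^ 3 = r ^ 3"
  shows "s = r"
proof -
  have "0 < Re (s * s)" "0 < Re (s * r)" "0 < Re (r * r)"
    using assms by (auto simp: wedge_def simp del: times_complex.simps intro!: Re_mult_wedge)
  then have "s * s + s * r + r * r \<noteq> 0"
    by (metis add_pos_pos plus_complex.simps(1) zero_complex.simps(1) less_irrefl)
  moreover have "(s - r) * (s * s + s * r + r * r) = s ^ 3 - r ^ 3"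
    by (simp add: algebra_simps power3_eq_cube)
  ultimately show ?thesis using assms(3) by auto
qed

text \<open>The hypotheses say that the argument of \<open>s\<close> is at most pi/3 in modulus, so
  cubing triples it without wrapping around. The left side says that the argument of
  \<open>s ^ 3\<close> is below 3 pi/4 in modulus.\<close>

lemma cube_in_sector_iff:
  assumes "Re s \<ge> 0" "s \<noteq> 0" "(Im s)\<^sup>2 \<le> 3 * (Re s)\<^sup>2"
  shows "0 < Re (s ^ 3) + \<bar>Im (s ^ 3)\<bar> \<longleftrightarrow> s \<in> wedge"
proof -
  define x t where "x = Re s" and "t = \<bar>Im s\<bar>"
  have t2: "(Im s)\<^sup>2 = t\<^sup>2" by (simp add: t_def)
  have "Im (s ^ 3) = Im s * (3 * x\<^sup>2 - t\<^sup>2)"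
    by (simp add: x_def t_def power3_eq_cube power2_eq_square algebra_simps)
  moreover have "3 * x\<^sup>2 - t\<^sup>2 \<ge> 0" using assms(3) by (simp add: x_def t2)
  ultimately have "\<bar>Im (s ^ 3)\<bar> = t * (3 * x\<^sup>2 - t\<^sup>2)"
    by (simp add: abs_mult t_def)
  moreover have "Re (s ^ 3) = x ^ 3 - 3 * x * t\<^sup>2"
    by (simp add: x_def flip: t2) (simp add: power3_eq_cube power2_eq_square algebra_simps)
  ultimately have eq: "Re (s ^ 3) + \<bar>Im (s ^ 3)\<bar> = (x - t) * (x\<^sup>2 + 4 * x * t + t\<^sup>2)"
    by (simp add: power3_eq_cube power2_eq_square algebra_simps)
  have x: "x > 0"
    using assms by (auto simp: x_def complex_eq_iff order_less_le)
  have "t \<ge> 0" by (simp add: t_def)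
  with x have "x\<^sup>2 + 4 * x * t + t\<^sup>2 > 0"
    by (smt (verit) mult_nonneg_nonneg zero_le_power2 zero_less_power2)
  then show ?thesis
    unfolding eq by (simp add: zero_less_mult_iff wedge_def x_def t_def)
qed

lemma wedge_cube:
  assumes "s \<in> wedge"
  shows "0 < Re (s ^ 3) + \<bar>Im (s ^ 3)\<bar>"
proof (subst cube_in_sector_iff)
  have "\<bar>Im s\<bar> ^ 2 \<le> (Re s)\<^sup>2"
    using assms by (intro power_mono) (auto simp: wedge_def)
  then show "(Im s)\<^sup>2 \<le> 3 * (Re s)\<^sup>2" using zero_le_power2[of "Re s"]
    unfolding power2_abs by linarith
qed (use assms in \<open>auto simp: wedge_def\<close>)

text \<open>The principal cube root has argument at most pi/3 in modulus, which is the range in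
  which \<open>cube_in_sector_iff\<close> decides membership in \<open>wedge\<close>.\<close>

lemma wedge_cube_surj:
  assumes w: "0 < Re w + \<bar>Im w\<bar>"
  obtains s where "s \<in> wedge" "s ^ 3 = w"
proof -
  have w0: "w \<noteq> 0" using w by auto
  define s where "s = exp (Ln w / 3)"
  have s3: "s ^ 3 = w"
    using w0 by (simp add: s_def flip: exp_of_nat_mult)
  have "cos (pi / 3) \<le> cos \<bar>Im (Ln w) / 3\<bar>"
    using w0 mpi_less_Im_Ln[of w] Im_Ln_le_pi[of w] by (subst cos_mono_le_eq) auto
  then have "1 / 2 \<le> cos (Im (Ln w) / 3)"
    by (simp only: cos_60 cos_abs_real)
  then have re: "norm s \<le> 2 * Re s"
    by (simp add: s_def Re_exp norm_exp_eq_Re)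
  then have "(norm s)\<^sup>2 \<le> (2 * Re s)\<^sup>2" by (intro power_mono) auto
  then have "(Im s)\<^sup>2 \<le> 3 * (Re s)\<^sup>2" by (simp add: cmod_power2 power_mult_distrib)
  moreover have "Re s \<ge> 0" using re norm_ge_zero[of s] by linarith
  ultimately have "s \<in> wedge"
    using cube_in_sector_iff[of s] w s3 by (auto simp: s_def)
  with s3 show ?thesis using that by blast
qed

section \<open>The coordinate \<open>s\<close> and the lens map\<close>

text \<open>Squaring followed by the inverse Cayley transform. The point 1 of the sector corresponds
  to infinity and is therefore excluded throughout; the corner 0 corresponds to
  \<open>z = 1\<close>.\<close>

definition wedge_to_ext :: "complex \<Rightarrow> complex" where
  "wedge_to_ext s = (1 + s\<^sup>2) / (1 - s\<^sup>2)"

definition ext_to_wedge :: "complex \<Rightarrow> complex" where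
  "ext_to_wedge z = csqrt ((z - 1) / (z + 1))"

lemma Re_csqrt_wedge:
  assumes "Re w > 0" shows "csqrt w \<in> wedge"
proof -
  define s where "s = csqrt w"
  have "s\<^sup>2 = w" by (simp add: s_def)
  then have "(Re s)\<^sup>2 - (Im s)\<^sup>2 > 0"
    using assms by (simp add: power2_eq_square flip: \<open>s\<^sup>2 = w\<close>)
  then have "\<bar>Im s\<bar> < \<bar>Re s\<bar>" by (simp add: abs_le_square_iff flip: not_le)
  moreover have "Re s \<ge> 0" using csqrt_principal[of w] by (auto simp: s_def)
  ultimately show ?thesis by (simp add: wedge_def s_def)
qed

lemma Re_cayley_pos: "norm z > 1 \<Longrightarrow> 0 < Re ((z - 1) / (z + 1))"
proof -
  assume z: "norm z > 1"
  then have "z + 1 \<noteq> 0" by (auto simp: add_eq_0_iff2)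
  then have p: "(Re z + 1)\<^sup>2 + (Im z)\<^sup>2 > 0"
    by (auto simp: complex_eq_iff sum_power2_gt_zero_iff)
  have "(Re z)\<^sup>2 + (Im z)\<^sup>2 > 1" using z by (simp add: cmod_def)
  then show ?thesis using p
    by (auto simp: Re_divide power2_eq_square algebra_simps intro!: divide_pos_pos)
qed

lemma ext_to_wedge:
  assumes "z \<in> ext_disk"
  shows "ext_to_wedge z \<in> wedge" "ext_to_wedge z \<noteq> 1" "wedge_to_ext (ext_to_wedge z) = z"
proof -
  define T where "T = (z - 1) / (z + 1)"
  have z: "z + 1 \<noteq> 0" using ext_diskD[OF assms] by (auto simp: add_eq_0_iff2)
  have s2: "(ext_to_wedge z)\<^sup>2 = T" by (simp add: ext_to_wedge_def T_def)
  have "T \<noteq> 1" using z by (auto simp: T_def field_simps)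
  then show "ext_to_wedge z \<noteq> 1" using s2 by auto
  show "ext_to_wedge z \<in> wedge"
    unfolding ext_to_wedge_def using assms by (intro Re_csqrt_wedge Re_cayley_pos) (simp add: ext_disk_def)
  show "wedge_to_ext (ext_to_wedge z) = z"
  proof -
    have "1 + T = 2 * z / (z + 1)" "1 - T = 2 / (z + 1)"
      using z by (simp_all add: T_def field_simps)
    then show ?thesis
      unfolding wedge_to_ext_def s2 using z by simp
  qed
qed

lemma wedge_to_ext:
  assumes s: "s \<in> wedge" "s \<noteq> 1"
  shows "wedge_to_ext s \<in> ext_disk" "ext_to_wedge (wedge_to_ext s) = s"
proof -
  have "0 < Re (s * s)"
    using s by (intro Re_mult_wedge) (auto simp: wedge_def)
  then have re: "0 < Re (s\<^sup>2)" by (simp add: power2_eq_square)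
  have s2: "1 - s\<^sup>2 \<noteq> 0"
    using s by (auto simp: wedge_def power2_eq_1_iff)
  have "(norm (1 - s\<^sup>2))\<^sup>2 < (norm (1 + s\<^sup>2))\<^sup>2"
    using re unfolding cmod_power2 by (simp add: power2_eq_square[of "1 + _"] power2_eq_square[of "1 - _"] algebra_simps)
  then have "norm (1 - s\<^sup>2) < norm (1 + s\<^sup>2)" 
    by (rule power_less_imp_less_base) simp
  then show "wedge_to_ext s \<in> ext_disk"
    using s2 by (simp add: wedge_to_ext_def ext_disk_def norm_divide)
  have "(wedge_to_ext s - 1) / (wedge_to_ext s + 1) = s\<^sup>2"
    using s2 by (simp add: wedge_to_ext_def divide_simps) 
  then show "ext_to_wedge (wedge_to_ext s) = s"
    using s unfolding ext_to_wedge_def by (simp only: csqrt_unique) (auto simp: wedge_def intro!: csqrt_unique)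
qed

text \<open>The factor \<open>3 / 2\<close> makes the leading Laurent coefficient of \<open>lens_map\<close> equal to 1.\<close>

definition wedge_to_lens :: "complex \<Rightarrow> complex" where
  "wedge_to_lens s = 3 / 2 * (1 + s ^ 3) / (1 - s ^ 3)"

definition lens_map :: "complex \<Rightarrow> complex" where
  "lens_map z = wedge_to_lens (ext_to_wedge z)"

definition lens :: "complex set" where
  "lens = cball (3 / 2 * \<i>) (3 / 2 * sqrt 2) \<inter> cball (- (3 / 2 * \<i>)) (3 / 2 * sqrt 2)"

text \<open>The Moebius map sends 0 and infinity to the corners of the lens, so the two discs pull
  back to half-planes bounded by lines through 0, namely \<open>Re w \<le> Im w\<close> and
  \<open>Re w \<le> - Im w\<close>.\<close>

lemma lens_iff:
  assumes w: "w \<noteq> 1"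
  shows "3 / 2 * (1 + w) / (1 - w) \<in> lens \<longleftrightarrow> Re w + \<bar>Im w\<bar> \<le> 0"
proof -
  have nz: "1 - w \<noteq> 0" using w by auto
  \<comment> \<open>Both discs are treated at once: \<open>e\<close> is \<open>\<i>\<close> or
    \<open>- \<i>\<close>, and clearing the denominator leaves an inequality between squared
    norms.\<close>
  have *: "dist c (3 / 2 * (1 + w) / (1 - w)) \<le> 3 / 2 * sqrt 2 \<longleftrightarrow>
      (norm (1 + w - e * (1 - w)))\<^sup>2 \<le> 2 * (norm (1 - w))\<^sup>2" if c: "c = 3 / 2 * e" for c e
  proof -
    have "3 / 2 * (1 + w) / (1 - w) - c = 3 / 2 * ((1 + w - e * (1 - w)) / (1 - w))"
      using nz by (simp add: c field_simps)
    then have "dist c (3 / 2 * (1 + w) / (1 - w)) = norm (3 / 2 * ((1 + w - e * (1 - w)) / (1 - w)))"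
      unfolding dist_norm by (subst norm_minus_commute) (rule arg_cong)
    also have "\<dots> = 3 / 2 * (norm (1 + w - e * (1 - w)) / norm (1 - w))"
      by (simp only: norm_mult norm_divide) simp
    finally have "dist c (3 / 2 * (1 + w) / (1 - w)) = \<dots>" .
    then have "dist c (3 / 2 * (1 + w) / (1 - w)) \<le> 3 / 2 * sqrt 2 \<longleftrightarrow>
        norm (1 + w - e * (1 - w)) \<le> sqrt 2 * norm (1 - w)"
      using nz by (simp add: pos_divide_le_eq)
    also have "\<dots> \<longleftrightarrow> (norm (1 + w - e * (1 - w)))\<^sup>2 \<le> (sqrt 2 * norm (1 - w))\<^sup>2"
      by (simp add: abs_le_square_iff[symmetric])
    finally show ?thesis by (simp add: power_mult_distrib)
  qed
  show ?thesis
    unfolding lens_def Int_iff mem_cball *[OF refl] *[of "- (3 / 2 * \<i>)" "- \<i>", OF mult_minus_right[symmetric]]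
    by (simp add: cmod_power2) (auto simp: power2_eq_square algebra_simps)
qed

text \<open>Cubing maps \<open>wedge\<close> onto the sector
  \<open>0 < Re w + \<bar>Im w\<bar>\<close>, whose complement corresponds to the lens by
  \<open>lens_iff\<close>.\<close>

lemma lens_map_image: "lens_map ` ext_disk = - lens"
proof (intro set_eqI iffI)
  fix g assume "g \<in> lens_map ` ext_disk"
  then obtain z where z: "z \<in> ext_disk" and g: "g = lens_map z" by auto
  note s = ext_to_wedge[OF z]
  have "ext_to_wedge z ^ 3 \<noteq> 1"
    using wedge_cube_inj[OF s(1) one_in_wedge] s(2) by auto
  then show "g \<in> - lens"
    using lens_iff wedge_cube[OF s(1)] by (simp add: g lens_map_def wedge_to_lens_def)
next
  fix g assume g: "g \<in> - lens"
  \<comment> \<open>The corner -3/2 lies on both circles, hence in the lens. This keeps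
    \<open>g\<close> away from the pole of the inverse Moebius map.\<close>
  have "norm (3 / 2 * (1 + \<i>)) = 3 / 2 * sqrt 2" "norm (3 / 2 * (1 - \<i>)) = 3 / 2 * sqrt 2"
    by (simp_all only: norm_mult) (simp_all add: cmod_def)
  moreover have "3 / 2 * \<i> - - (3 / 2) = 3 / 2 * (1 + \<i>)" "- (3 / 2 * \<i>) - - (3 / 2) = 3 / 2 * (1 - \<i>)"
    by (simp_all add: algebra_simps)
  ultimately have "- (3 / 2) \<in> lens"
    by (simp only: lens_def dist_norm Int_iff mem_cball order.refl simp_thms)
  with g have "g \<noteq> - (3 / 2)" by auto
  then have nz: "2 * g + 3 \<noteq> 0" by (simp add: eq_neg_iff_add_eq_0 field_simps)
  define w where "w = (2 * g - 3) / (2 * g + 3)"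
  have "1 + w = 4 * g / (2 * g + 3)" and w: "1 - w = 6 / (2 * g + 3)"
    using nz by (simp_all add: w_def field_simps)
  then have gw: "g = 3 / 2 * (1 + w) / (1 - w)"
    using nz by simp
  have w1: "w \<noteq> 1" using nz w by auto
  have "0 < Re w + \<bar>Im w\<bar>" using g lens_iff[OF w1] by (auto simp: gw)
  then obtain s where s: "s \<in> wedge" "s ^ 3 = w" by (rule wedge_cube_surj)
  have "s \<noteq> 1" using s w1 by auto
  note wedge_to_ext[OF s(1) this]
  then show "g \<in> lens_map ` ext_disk"
    using s by (intro image_eqI[of _ _ "wedge_to_ext s"]) (simp_all add: lens_map_def wedge_to_lens_def gw)
qed

lemma wedge_cube_ne_1: "s \<in> wedge \<Longrightarrow> s \<noteq> 1 \<Longrightarrow> s ^ 3 \<noteq> 1"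
  using wedge_cube_inj[OF _ one_in_wedge] by auto

lemma lens_map_inj: "inj_on lens_map ext_disk"
proof
  fix z y assume z: "z \<in> ext_disk" and y: "y \<in> ext_disk" and eq: "lens_map z = lens_map y"
  note sz = ext_to_wedge[OF z] and sy = ext_to_wedge[OF y]
  define u v where "u = ext_to_wedge z ^ 3" and "v = ext_to_wedge y ^ 3"
  have "u \<noteq> 1" "v \<noteq> 1"
    unfolding u_def v_def using sz sy wedge_cube_ne_1 by auto
  then have "1 - u \<noteq> 0" "1 - v \<noteq> 0" by auto
  moreover have "3 / 2 * (1 + u) / (1 - u) = 3 / 2 * (1 + v) / (1 - v)"
    using eq unfolding lens_map_def wedge_to_lens_def u_def v_def .
  then have "(1 + u) / (1 - u) = (1 + v) / (1 - v)"
    by (simp only: times_divide_eq_right[symmetric] mult_cancel_left) simp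
  ultimately have "(1 + u) * (1 - v) = (1 + v) * (1 - u)"
    by (simp add: frac_eq_eq algebra_simps)
  then have "u = v" by (simp add: algebra_simps)
  then have "ext_to_wedge z = ext_to_wedge y"
    using wedge_cube_inj sz(1) sy(1) by (simp add: u_def v_def)
  then show "z = y" using sz(3) sy(3) by metis
qed

section \<open>The difference quotient of the lens map\<close>

text \<open>The closure of \<open>wedge\<close>. Its edges parametrize the unit circle without the
  point -1, and so carry the boundary values.\<close>

definition cone :: "complex set" where
  "cone = {s. \<bar>Im s\<bar> \<le> Re s}"

lemma wedge_subset_cone: "wedge \<subseteq> cone"
  by (auto simp: wedge_def cone_def)

lemma zero_notin_wedge: "0 \<notin> wedge"
  by (simp add: wedge_def)

lemma wedge_inverse: "s \<in> wedge \<Longrightarrow> inverse s \<in> wedge"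
  by (auto simp: wedge_def inverse_complex.simps abs_divide sum_power2_gt_zero_iff
      intro!: divide_strict_right_mono)

lemma cone_inverse: "s \<in> cone \<Longrightarrow> inverse s \<in> cone"
  by (auto simp: cone_def inverse_complex.simps intro!: divide_right_mono)

lemma cone_add_wedge: "s \<in> cone \<Longrightarrow> r \<in> wedge \<Longrightarrow> s + r \<in> wedge"
  by (auto simp: wedge_def cone_def)

text \<open>The difference quotient of \<open>lens_map\<close> is a positive multiple of
  \<open>(s\<^sup>2 + s * r + r\<^sup>2) / (s + r) * tilt s * tilt r\<close>, whose first factor is a positive combination of
  \<open>s\<close> and \<open>r\<close>. So it suffices that \<open>tilt s\<close> and \<open>s * tilt s\<close> stay in the wedge. The latter follows from
  the former through \<open>s * tilt s = tilt (1 / s)\<close>.\<close>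

definition tilt :: "complex \<Rightarrow> complex" where
  "tilt s = (1 + s) / (1 + s + s\<^sup>2)"

text \<open>The quantity \<open>s + inverse (1 + s)\<close> is the reciprocal of
  \<open>tilt s\<close>. It is a sum of a point of \<open>cone\<close> and a point of
  \<open>wedge\<close>, which gives both its position and the nonvanishing of the
  denominator.\<close>

lemma tilt_denominator:
  assumes "s \<in> cone"
  shows "1 + s \<noteq> 0" "1 + s + s\<^sup>2 \<noteq> 0" "s + inverse (1 + s) \<in> wedge"
proof -
  have "s + 1 \<in> wedge" using assms one_in_wedge by (rule cone_add_wedge)
  then have w: "1 + s \<in> wedge" by (simp add: add.commute)
  then show nz: "1 + s \<noteq> 0" by (auto simp: wedge_def complex_eq_iff)
  show u: "s + inverse (1 + s) \<in> wedge"
    using assms wedge_inverse[OF w] by (rule cone_add_wedge)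
  have "1 + s + s\<^sup>2 = (s + inverse (1 + s)) * (1 + s)"
    using nz by (simp add: field_simps power2_eq_square)
  moreover have "s + inverse (1 + s) \<noteq> 0" using u by (metis zero_notin_wedge)
  ultimately show "1 + s + s\<^sup>2 \<noteq> 0" using nz by simp
qed

lemma tilt_in_wedge:
  assumes "s \<in> cone"
  shows "tilt s \<in> wedge"
proof -
  note nz = tilt_denominator[OF assms]
  have "tilt s = inverse (s + inverse (1 + s))"
    using nz(1,2) by (simp add: tilt_def field_simps power2_eq_square)
  then show ?thesis using wedge_inverse[OF nz(3)] by simp
qed

lemma mult_tilt_in_wedge:
  assumes "s \<in> cone" "s \<noteq> 0"
  shows "s * tilt s \<in> wedge"
proof -
  have "s * tilt s = tilt (inverse s)"
    using assms tilt_denominator[OF assms(1)]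
      tilt_denominator[OF cone_inverse[OF assms(1)]]
    unfolding tilt_def by (simp add: divide_simps power2_eq_square) (simp add: algebra_simps)
  then show ?thesis using tilt_in_wedge[OF cone_inverse[OF assms(1)]] by simp
qed

text \<open>Expand after multiplying numerator and denominator by \<open>cnj (s + r)\<close>. For
  \<open>s\<close> and \<open>r\<close> in \<open>cone\<close> the real part of
  \<open>s * cnj r\<close> is nonnegative, so both coefficients are nonnegative.\<close>

lemma cube_mean_eq:
  assumes "s + r \<noteq> 0"
  shows "(s\<^sup>2 + s * r + r\<^sup>2) / (s + r) =
    (of_real ((norm s)\<^sup>2 + 2 * Re (s * cnj r)) * s + of_real ((norm r)\<^sup>2 + 2 * Re (s * cnj r)) * r)
      / of_real ((norm (s + r))\<^sup>2)"
proof -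
  have "2 * of_real (Re (s * cnj r)) = s * cnj r + cnj s * r"
    by (simp add: complex_eq_iff)
  then have "(of_real ((norm s)\<^sup>2 + 2 * Re (s * cnj r)) * s + of_real ((norm r)\<^sup>2 + 2 * Re (s * cnj r)) * r)
     = (s\<^sup>2 + s * r + r\<^sup>2) * cnj (s + r)"
    unfolding of_real_add of_real_mult of_real_numeral complex_norm_square
    by (simp only: complex_cnj_add) (simp add: algebra_simps power2_eq_square)
  moreover have "of_real ((norm (s + r))\<^sup>2) = (s + r) * cnj (s + r)"
    by (rule complex_norm_square)
  ultimately show ?thesis using assms
    by (simp del: complex_cnj_add)
qed

text \<open>Here \<open>r\<close> may be any boundary parameter, including 0: the corner value is
  one of the three omitted values used at the end.\<close>

lemma lens_difference_quotient:
  assumes s: "s \<in> cone" "s \<noteq> 0" "s \<noteq> 1" and r: "r \<in> cone" "r \<noteq> 1"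
  obtains q where "0 < Re q" "wedge_to_lens s - wedge_to_lens r = q * (wedge_to_ext s - wedge_to_ext r)"
proof -
  define m where "m = (s\<^sup>2 + s * r + r\<^sup>2) / (s + r)"
  define q where "q = 3 / 2 * (m * tilt s * tilt r)"
  have pos: "Re s > 0" "Re r \<ge> 0" using s r by (auto simp: cone_def complex_eq_iff)
  then have sr: "s + r \<noteq> 0" by (auto simp: complex_eq_iff)
  define \<alpha> \<beta> where "\<alpha> = (norm s)\<^sup>2 + 2 * Re (s * cnj r)" and "\<beta> = (norm r)\<^sup>2 + 2 * Re (s * cnj r)"
  have "\<bar>Im s * Im r\<bar> \<le> Re s * Re r"
    unfolding abs_mult using s r by (intro mult_mono) (auto simp: cone_def)
  then have "Re (s * cnj r) \<ge> 0" by simp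
  then have ab: "\<alpha> > 0" "\<beta> \<ge> 0" using s by (auto simp: \<alpha>_def \<beta>_def add_pos_nonneg)
  have t: "0 < Re (s * tilt s * tilt r)" "0 \<le> Re (r * tilt r * tilt s)"
  proof -
    have *: "0 < Re (x * y)" if "x \<in> wedge" "y \<in> wedge" for x y
      using that by (intro Re_mult_wedge) (auto simp: wedge_def)
    show "0 < Re (s * tilt s * tilt r)"
      using mult_tilt_in_wedge s tilt_in_wedge r by (intro *) auto
    show "0 \<le> Re (r * tilt r * tilt s)"
    proof (cases "r = 0")
      case False
      then show ?thesis
        using mult_tilt_in_wedge s tilt_in_wedge r by (intro less_imp_le[OF *]) auto
    qed simp
  qed
  have "m * tilt s * tilt r = (of_real \<alpha> * (s * tilt s * tilt r) + of_real \<beta> * (r * tilt r * tilt s)) /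
      of_real ((norm (s + r))\<^sup>2)"
    unfolding m_def cube_mean_eq[OF sr] \<alpha>_def[symmetric] \<beta>_def[symmetric] by (simp add: algebra_simps add_divide_distrib)
  then have "Re (m * tilt s * tilt r) = (\<alpha> * Re (s * tilt s * tilt r) + \<beta> * Re (r * tilt r * tilt s)) / (norm (s + r))\<^sup>2"
    by (simp only: Re_divide_of_real plus_complex.simps Re_complex_of_real Im_complex_of_real times_complex.simps mult_zero_left diff_zero)
  also have "\<dots> > 0"
    using ab t sr by (intro divide_pos_pos add_pos_nonneg mult_pos_pos mult_nonneg_nonneg) auto
  finally have "Re q > 0" by (simp add: q_def)
  moreover have "wedge_to_lens s - wedge_to_lens r = q * (wedge_to_ext s - wedge_to_ext r)"
  proof -
    note ns = tilt_denominator[OF s(1)] and nr = tilt_denominator[OF r(1)]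
    define P R where "P = 1 + s + s\<^sup>2" and "R = 1 + r + r\<^sup>2"
    have f: "1 - s ^ 3 = (1 - s) * P" "1 - r ^ 3 = (1 - r) * R"
      "1 - s\<^sup>2 = (1 - s) * (1 + s)" "1 - r\<^sup>2 = (1 - r) * (1 + r)"
      by (simp_all add: P_def R_def algebra_simps power2_eq_square power3_eq_cube)
    have nz: "1 - s \<noteq> 0" "1 - r \<noteq> 0" "P \<noteq> 0" "R \<noteq> 0" using s r ns nr by (auto simp: P_def R_def)
    have "wedge_to_lens s - wedge_to_lens r =
        3 * ((s - r) * (s\<^sup>2 + s * r + r\<^sup>2)) / ((1 - s ^ 3) * (1 - r ^ 3))"
    proof -
      have "1 - s ^ 3 \<noteq> 0" "1 - r ^ 3 \<noteq> 0" using nz f by auto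
      then show ?thesis
        unfolding wedge_to_lens_def by (simp add: divide_simps) (simp add: algebra_simps power2_eq_square power3_eq_cube)
    qed
    moreover have "wedge_to_ext s - wedge_to_ext r = 2 * ((s - r) * (s + r)) / ((1 - s\<^sup>2) * (1 - r\<^sup>2))"
    proof -
      have "1 - s\<^sup>2 \<noteq> 0" "1 - r\<^sup>2 \<noteq> 0" using nz ns nr f by auto
      then show ?thesis
        unfolding wedge_to_ext_def by (simp add: divide_simps) (simp add: algebra_simps power2_eq_square)
    qed
    ultimately show ?thesis
      using nz ns(1) nr(1) sr
      by (simp add: f q_def m_def tilt_def flip: P_def R_def)
  qed
  ultimately show ?thesis using that by blast
qed

section \<open>The Laurent expansion of the lens map\<close>

lemma lens_map_in_class_Sigma: "lens_map \<in> class_Sigma"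
proof (rule class_SigmaI)
  define S where "S w = csqrt ((1 - w) / (1 + w))" for w
  \<comment> \<open>This is \<open>wedge_to_lens s - wedge_to_ext s\<close> over a common
    denominator. The numerator has a double zero at \<open>s = 1\<close>, so the pole cancels and
    \<open>k\<close> is holomorphic at \<open>w = 0\<close>.\<close>
  define k where "k w = (1 - S w) * ((S w)\<^sup>2 + 3 * S w + 1) / (2 * (1 + S w) * (1 + S w + (S w)\<^sup>2))" for w
  have ball: "1 + w \<noteq> 0" "0 < Re ((1 - w) / (1 + w))" if w: "w \<in> ball 0 1" for w
  proof -
    show nz: "1 + w \<noteq> 0" using w by (auto simp: add_eq_0_iff)
    show "0 < Re ((1 - w) / (1 + w))"
    proof (cases "w = 0")
      case False
      then have "(1 - w) / (1 + w) = (1 / w - 1) / (1 / w + 1)"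
        by (simp add: divide_simps)
      moreover have "norm (1 / w) > 1" using w False by (simp add: norm_divide)
      ultimately show ?thesis using Re_cayley_pos by presburger
    qed simp
  qed
  have "S w \<in> cone" if "w \<in> ball 0 1" for w
    unfolding S_def using Re_csqrt_wedge[OF ball(2)[OF that]] wedge_subset_cone by auto
  note nz = tilt_denominator(1,2)[OF this]
  have "(1 - w) / (1 + w) \<notin> \<real>\<^sub>\<le>\<^sub>0" if "w \<in> ball 0 1" for w :: complex
    using ball(2)[OF that] by (auto simp: complex_nonpos_Reals_iff)
  then have "S holomorphic_on ball 0 1"
    unfolding S_def
    by (intro holomorphic_intros ball(1)) auto
  then show "k holomorphic_on ball 0 1"
    unfolding k_def using nz
    by (intro holomorphic_intros) (auto simp del: distrib_left_numeral)
  show "inj_on lens_map ext_disk" by (rule lens_map_inj)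
  show "lens_map z = z + k (1 / z)" if z: "z \<in> ext_disk" for z
  proof -
    define s where "s = ext_to_wedge z"
    have "S (1 / z) = s"
      using ext_diskD[OF z] by (simp add: S_def s_def ext_to_wedge_def divide_simps)
    then have k: "k (1 / z) = (1 - s) * (s\<^sup>2 + 3 * s + 1) / (2 * (1 + s) * (1 + s + s\<^sup>2))"
      by (simp add: k_def)
    note s = ext_to_wedge[OF z, folded s_def]
    have n: "1 - s \<noteq> 0" "1 + s \<noteq> 0" "1 + s + s\<^sup>2 \<noteq> 0"
      using s tilt_denominator[of s] wedge_subset_cone by auto
    have f: "1 - s ^ 3 = (1 - s) * (1 + s + s\<^sup>2)" "1 - s\<^sup>2 = (1 - s) * (1 + s)"
      by (simp_all add: algebra_simps power2_eq_square power3_eq_cube)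
    have "wedge_to_lens s = wedge_to_ext s + k (1 / z)"
      unfolding wedge_to_lens_def wedge_to_ext_def k f using n
      by (simp add: divide_simps del: distrib_left_numeral) (simp add: algebra_simps power2_eq_square power3_eq_cube)
    then show ?thesis using s(3) by (simp add: lens_map_def s_def)
  qed
qed

lemma exterior_convex_lens_map: "exterior_convex lens_map"
proof -
  have "omitted_set lens_map = lens"
    by (simp add: omitted_set_def lens_map_image)
  then show ?thesis
    unfolding exterior_convex_def
    by (auto simp: lens_def lens_map_in_class_Sigma intro!: convex_Int bounded_Int)
qed

section \<open>The mean and its boundary values\<close>

definition wedge_to_mean :: "complex \<Rightarrow> complex \<Rightarrow> complex" where
  "wedge_to_mean a s = (wedge_to_ext s + a / wedge_to_ext s) / 2 + wedge_to_lens s / 2"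

lemma norm_wedge_to_ext_ge:
  assumes "r \<in> cone" "r \<noteq> 1"
  shows "1 \<le> norm (wedge_to_ext r)"
proof -
  have "\<bar>Im r\<bar> ^ 2 \<le> (Re r)\<^sup>2" using assms by (intro power_mono) (auto simp: cone_def)
  then have "Re (r\<^sup>2) \<ge> 0" by (simp add: power2_eq_square)
  then have "(norm (1 - r\<^sup>2))\<^sup>2 \<le> (norm (1 + r\<^sup>2))\<^sup>2"
    unfolding cmod_power2 by (simp add: power2_eq_square[of "1 + _"] power2_eq_square[of "1 - _"] algebra_simps)
  then have "norm (1 - r\<^sup>2) \<le> norm (1 + r\<^sup>2)" 
    by (rule power2_le_imp_le) simp
  moreover have "1 - r\<^sup>2 \<noteq> 0"
    using assms by (auto simp: cone_def power2_eq_1_iff)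
  ultimately show ?thesis
    by (simp add: wedge_to_ext_def norm_divide le_divide_eq)
qed

text \<open>The difference of the two values is
  \<open>((1 - a / (z * y)) + q) * (z - y) / 2\<close>. Both summands in the first factor have
  positive real part, since \<open>norm (a / (z * y)) < 1\<close>.\<close>

lemma wedge_to_mean_omitted:
  assumes a: "norm a = 1" and r: "r \<in> cone" "r \<notin> wedge" and s: "s \<in> wedge" "s \<noteq> 1"
  shows "wedge_to_mean a s \<noteq> wedge_to_mean a r"
proof -
  define z y where "z = wedge_to_ext s" and "y = wedge_to_ext r"
  have s': "s \<in> cone" "s \<noteq> 0" using s wedge_subset_cone by (auto simp: wedge_def)
  have r1: "r \<noteq> 1" using r one_in_wedge by auto
  obtain q where q: "0 < Re q" "wedge_to_lens s - wedge_to_lens r = q * (z - y)"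
    using lens_difference_quotient[OF s' s(2) r(1) r1] unfolding z_def y_def by blast
  have nz: "norm z > 1" using wedge_to_ext(1)[OF s] by (simp add: z_def ext_disk_def)
  have ny: "norm y \<ge> 1" using norm_wedge_to_ext_ge[OF r(1) r1] by (simp add: y_def)
  have n: "norm (z * y) > 1" using nz ny using mult_left_mono[of 1 "norm y" "norm z"] by (simp add: norm_mult)
  have zy: "z \<noteq> 0" "y \<noteq> 0" using nz ny by auto
  have "norm (a / (z * y)) < 1" using n a by (simp add: norm_divide divide_less_eq)
  then have "Re (1 - a / (z * y)) > 0"
    using complex_Re_le_cmod[of "a / (z * y)"] by (simp only: minus_complex.simps one_complex.simps)
  then have ne: "(1 - a / (z * y)) + q \<noteq> 0"
    using q(1) by (metis add_pos_pos plus_complex.simps(1) zero_complex.simps(1) less_irrefl)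
  have "s\<^sup>2 \<noteq> r\<^sup>2"
    using s r by (auto simp: power2_eq_iff wedge_def cone_def)
  moreover have "1 - s\<^sup>2 \<noteq> 0" "1 - r\<^sup>2 \<noteq> 0"
    using s' s r r1 by (auto simp: cone_def power2_eq_1_iff)
  ultimately have "z \<noteq> y"
    by (simp add: z_def y_def wedge_to_ext_def frac_eq_eq algebra_simps)
  have "wedge_to_mean a s - wedge_to_mean a r =
      ((z + a / z) - (y + a / y) + (wedge_to_lens s - wedge_to_lens r)) / 2"
    by (simp add: wedge_to_mean_def z_def y_def diff_divide_distrib add_divide_distrib)
  also have "\<dots> = ((1 - a / (z * y)) + q) * (z - y) / 2"
    unfolding q(2) using zy by (simp add: field_simps)
  finally show ?thesis using ne \<open>z \<noteq> y\<close> by auto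
qed

section \<open>The counterexample at rational parameters\<close>

theorem theorem1p2:
  shows "\<exists>(F :: complex \<Rightarrow> complex) (G :: complex \<Rightarrow> complex) (t :: real).
    exterior_convex F \<and> exterior_convex G \<and> 0 < t \<and> t < 1 \<and>
    \<not> (bounded (omitted_set (\<lambda>z. of_real t * F z + of_real (1 - t) * G z)) \<and>
       convex (omitted_set (\<lambda>z. of_real t * F z + of_real (1 - t) * G z)))"
proof -
  \<comment> \<open>A rational point of the unit circle. Since \<open>1 - a\<close> is
    \<open>Complex (1/5) (-3/5)\<close>, its argument exceeds pi/4 in modulus.\<close>
  define a where "a = Complex (4/5) (3/5)"
  define F where "F = (\<lambda>z. z + a / z)"
  define t :: real where "t = 1 / 2"
  define H where "H = (\<lambda>z. of_real t * F z + of_real (1 - t) * lens_map z)"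
  have a: "norm a = 1" by (simp add: a_def cmod_def power2_eq_square)
  have H: "H z = wedge_to_mean a (ext_to_wedge z)" if "z \<in> ext_disk" for z
    using ext_to_wedge(3)[OF that] by (simp add: H_def F_def t_def lens_map_def wedge_to_mean_def)
  have om: "wedge_to_mean a r \<in> omitted_set H" if "r \<in> cone" "r \<notin> wedge" for r
    using wedge_to_mean_omitted[OF a that] ext_to_wedge H by (fastforce simp: omitted_set_def)
  \<comment> \<open>The numbers below come from a computer search: the margin is small, because near \<open>s = 0\<close> the
    boundary bends outwards only at the order \<open>s ^ 3\<close>.\<close>
  have A: "wedge_to_mean a 0 = Complex (33/20) (3/10)"
    by (simp add: wedge_to_mean_def wedge_to_ext_def wedge_to_lens_def a_def complex_eq_iff)
  note eqs = complex_eq_iff power2_eq_square power3_eq_cube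
  \<comment> \<open>The values \<open>z\<close> and \<open>l\<close> are supplied as explicit
    rationals and verified by equations without division.\<close>
  have val: "wedge_to_mean a s = (z + a * cnj z / of_real ((norm z)\<^sup>2)) / 2 + l / 2"
    if "1 + s\<^sup>2 = z * (1 - s\<^sup>2)" "3 / 2 * (1 + s ^ 3) = l * (1 - s ^ 3)" "1 - s\<^sup>2 \<noteq> 0" "1 - s ^ 3 \<noteq> 0" for s z l
  proof -
    have "wedge_to_ext s = z" "wedge_to_lens s = l"
      using that by (simp_all add: wedge_to_ext_def wedge_to_lens_def)
    then show ?thesis
      unfolding wedge_to_mean_def by (subst complex_div_cnj[of a]) simp
  qed
  \<comment> \<open>This parameter and the next one lie on the lower edge of the sector, so their
    \<open>z\<close> are Pythagorean points of the unit circle.\<close>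
  have B: "wedge_to_mean a (Complex (1/3) (-1/3)) = Complex (76317/57460) (3837/28730)"
    by (subst val[of _ "Complex (77/85) (-36/85)" "Complex (2163/1690) (-162/845)"])
      (simp_all add: eqs a_def cmod_def)
  have C: "wedge_to_mean a (Complex 1 (-1)) = Complex (-1539/1300) (-319/650)"
    by (subst val[of _ "Complex (-3/5) (-4/5)" "Complex (-21/26) (-6/13)"])
      (simp_all add: eqs a_def cmod_def)
  \<comment> \<open>A point just inside the lower edge and close to the corner 0.\<close>
  define s where "s = Complex (27/281) (-26/281)"
  have M: "wedge_to_mean a s = Complex (392452021721/239805488910) (11717007037/39967581485)"
    unfolding s_def
    by (subst val[of _ "Complex (9867/9860) (-351/9860)" "Complex (16640937/11129156) (-58929/11129156)"])
      (simp_all add: eqs a_def cmod_def)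
  have s: "s \<in> wedge" "s \<noteq> 1" by (auto simp: s_def wedge_def complex_eq_iff)
  have "wedge_to_mean a s \<in> H ` ext_disk"
    using wedge_to_ext[OF s] H by (intro image_eqI[of _ _ "wedge_to_ext s"]) simp_all
  moreover have "wedge_to_mean a s \<in> convex hull
      {wedge_to_mean a 0, wedge_to_mean a (Complex (1/3) (-1/3)), wedge_to_mean a (Complex 1 (-1))}"
    unfolding convex_hull_3 A B C M mem_Collect_eq
    \<comment> \<open>The barycentric coordinates of the value at \<open>s\<close> in the triangle;
      all three are positive.\<close>
    by (rule exI[of _ "1 - 20945467981/520844500800 - 1394351399/7673775645120"],
        rule exI[of _ "20945467981/520844500800"], rule exI[of _ "1394351399/7673775645120"])
      (simp add: complex_eq_iff)
  moreover have "{wedge_to_mean a 0, wedge_to_mean a (Complex (1/3) (-1/3)), wedge_to_mean a (Complex 1 (-1))}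
      \<subseteq> omitted_set H"
    using om by (simp add: cone_def wedge_def)
  ultimately have "\<not> convex (omitted_set H)"
    using hull_minimal[of _ "omitted_set H" convex] unfolding omitted_set_def by blast
  moreover have "exterior_convex F"
    unfolding F_def using a by (rule exterior_convex_segment)
  ultimately show ?thesis
    using exterior_convex_lens_map unfolding H_def
    by (intro exI[of _ F] exI[of _ lens_map] exI[of _ t]) (simp add: t_def)
qed

end
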